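(* Suppose there exist a Lipschitz function $\gamma$ on $\mathbb{R}^+=[0,\infty)$ and numbers $\delta_N\ge 0$ ($N\ge1$) such that for every $N$ $$\sup_{x}\Bigl|\gamma_N(x)-\gamma\Bigl(\frac{x}{N}\Bigr)\Bigr|\le \delta_N ,$$ and suppose that $\delta_N\to0$ as $N\to\infty$ and $\bar\psi_N=o(N)$. Let $z$ be the solution of $\dot z=1+\gamma(z)$, $z(0)=0$. Then the scaled process $Z^N$ converges to $z$ in $L^1$ uniformly on compact time intervals, i.e. for every $T>0$, $$\lim_{N\to\infty}\mathbb E\Bigl[\sup_{t\in[0,T]}|Z^N_t-z(t)|\Bigr]=0 .$$
   Context: Setting. For each $N\ge 1$, items $V=\{1,\dots,N\}$ are the vertices of a random graph $\mathcal G$. Initially no item is explored. At each step one not-yet-explored item is selected and becomes active, and its neighbors among the not-yet-explored items become explored as well. Homogeneity assumption: if $(\mathcal G_1,\mathcal G_2)$ is a partition of $\mathcal G$ and $i\in\mathcal G_2$, the distribution of the number of neighbors of $i$ in $\mathcal G_2$ depends only on $|\mathcal G_1|$ and $|\mathcal G_2|$. For $|\mathcal G_1|=x$ this distribution is denoted $p_N(\cdot,x)$, $x\in\{0,\dots,N-1\}$ (a probability distribution on $\{0,\dots,N-x-1\}$). Let $Z_n$ be the total number of items that are active or explored after $n$ steps. Then $Z=(Z_n)_{n\ge0}$ is a discrete-time Markov chain on $\{0,\dots,N\}$ with $Z_0=0$, transition probabilities $P(Z_n=x+k+1\mid Z_{n-1}=x)=p_N(k,x)$ for $k\ge0$, $x<N$,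 and absorbing state $N$. Notation. $\gamma_N(x)=\sum_{k=0}^{N-1}k\,p_N(k,x)$ and $\psi_N(x)=\sum_{k=0}^{N-1}(k-\gamma_N(x))^2p_N(k,x)$ are the mean and variance of $p_N(\cdot,x)$; $\bar\psi_N=\sup_x\psi_N(x)$; suprema over $x$ are over $x\in\{0,\dots,N-1\}$. The scaled process is $Z^N_t=Z_{[tN]}/N$, $t\ge0$, with $[\cdot]$ the integer part.
   Formalization: As printed the limit fails once z(T)>1, because Z^N never exceeds 1 (empty graph: γ=0, z(t)=t, T=2). Proved instead: convergence to z for every T>0 with z(T)≤1, and, for every T>0, convergence to min(z(t),1). *)

theory Defs
  imports "HOL-Probability.Probability" "HOL-Library.Landau_Symbols"
begin

text \<open>Time-homogeneous Markov chain on a countable state space \<open>S\<close> with transition kernel \<open>K\<close>: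
  the whole past is conditioned on, not only the present state.\<close>

definition markov_chain ::
  "'a measure \<Rightarrow> 's set \<Rightarrow> ('s \<Rightarrow> 's pmf) \<Rightarrow> (nat \<Rightarrow> 'a \<Rightarrow> 's) \<Rightarrow> bool" where
  "markov_chain M S K X \<longleftrightarrow>
     prob_space M \<and> (\<forall>n. X n \<in> measurable M (count_space S)) \<and>
     (\<forall>n s. \<forall>y\<in>S.
        \<P>(\<omega> in M. \<forall>i\<le>n. X i \<omega> = s i) > 0 \<longrightarrow>
        \<P>(\<omega> in M. X (Suc n) \<omega> = y \<bar> \<forall>i\<le>n. X i \<omega> = s i) = pmf (K (s n)) y)"

text \<open>Below, \<open>p N x\<close> is the distribution \<open>p\<^sub>N(\<sqdot>, x)\<close> of the number of unexplored neighbours of the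
  item selected when \<open>x\<close> of the \<open>N\<close> items are already active or explored. The selected item
  itself accounts for the additional \<open>1\<close>; the state \<open>N\<close> is absorbing.\<close>

definition exploration_kernel :: "(nat \<Rightarrow> nat \<Rightarrow> nat pmf) \<Rightarrow> nat \<Rightarrow> nat \<Rightarrow> nat pmf" where
  "exploration_kernel p N x =
     (if x < N then map_pmf (\<lambda>k. x + k + 1) (p N x) else return_pmf N)"

definition exploration_chain ::
  "(nat \<Rightarrow> nat \<Rightarrow> nat pmf) \<Rightarrow> nat \<Rightarrow> 'a measure \<Rightarrow> (nat \<Rightarrow> 'a \<Rightarrow> nat) \<Rightarrow> bool" where
  "exploration_chain p N M Z \<longleftrightarrow>
     markov_chain M {0..N} (exploration_kernel p N) Z \<and> (AE \<omega> in M. Z 0 \<omega> = 0)"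

definition nb_mean :: "(nat \<Rightarrow> nat \<Rightarrow> nat pmf) \<Rightarrow> nat \<Rightarrow> nat \<Rightarrow> real" where
  "nb_mean p N x = (\<Sum>k<N. real k * pmf (p N x) k)"

definition nb_var :: "(nat \<Rightarrow> nat \<Rightarrow> nat pmf) \<Rightarrow> nat \<Rightarrow> nat \<Rightarrow> real" where
  "nb_var p N x = (\<Sum>k<N. (real k - nb_mean p N x)\<^sup>2 * pmf (p N x) k)"

definition nb_var_sup :: "(nat \<Rightarrow> nat \<Rightarrow> nat pmf) \<Rightarrow> nat \<Rightarrow> real" where
  "nb_var_sup p N = (SUP x\<in>{..<N}. nb_var p N x)"

definition scaled :: "nat \<Rightarrow> (nat \<Rightarrow> 'a \<Rightarrow> nat) \<Rightarrow> real \<Rightarrow> 'a \<Rightarrow> real" where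
  "scaled N Z t \<omega> = real (Z (nat \<lfloor>t * real N\<rfloor>) \<omega>) / real N"

text \<open>The vector field \<open>f\<close> is only meaningful on \<open>[0, \<infinity>)\<close>, so a solution has to stay there.
  The derivative at \<open>t = 0\<close> is one-sided.\<close>

definition solves_ivp_nonneg :: "(real \<Rightarrow> real) \<Rightarrow> (real \<Rightarrow> real) \<Rightarrow> real \<Rightarrow> bool" where
  "solves_ivp_nonneg f z z0 \<longleftrightarrow>
     z 0 = z0 \<and>
     (\<forall>t\<ge>0. z t \<ge> 0 \<and> (z has_real_derivative f (z t)) (at t within {0..}))"

end

theory Submission
  imports Defs
begin

text \<open>
  Stopping the limit \<open>z\<close> at \<open>1\<close> gives a function whose drift \<open>u \<mapsto> (1 + \<gamma> u) \<cdot> [u < 1]\<close> jumps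
  downwards at \<open>1\<close> and therefore still satisfies a one-sided Lipschitz condition. Hence the mean square
  distance between \<open>Z\<^sub>n / N\<close> and \<open>min (z (n / N)) 1\<close> obeys a discrete Gronwall recursion
  \<open>e\<^sub>n\<^sub>+\<^sub>1 \<le> (1 + 2 L / N) e\<^sub>n + \<epsilon>\<^sub>N / N\<close> with \<open>\<epsilon>\<^sub>N \<rightarrow> 0\<close>, which involves only the one-dimensional
  distributions of the chain. Because the chain and its limit are both nondecreasing, convergence at
  finitely many times upgrades to uniform convergence without a maximal inequality.
\<close>

subsection \<open>Markov chains with finitely many states\<close>

context
  fixes M :: "'a measure" and S :: "'s set" and K :: "'s \<Rightarrow> 's pmf" and X :: "nat \<Rightarrow> 'a \<Rightarrow> 's"
  assumes chain: "markov_chain M S K X" and finite_states: "finite S"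
begin

interpretation prob_space M
  using chain by (simp add: markov_chain_def)

lemma markov_chain_in_states: "\<omega> \<in> space M \<Longrightarrow> X n \<omega> \<in> S"
  using chain measurable_space[of "X n" M "count_space S"] by (simp add: markov_chain_def)

lemma markov_chain_state_sets: "{\<omega> \<in> space M. X n \<omega> = x} \<in> sets M"
proof -
  have "X n \<in> measurable M (count_space S)"
    using chain by (simp add: markov_chain_def)
  then have "X n -` ({x} \<inter> S) \<inter> space M \<in> sets M"
    by (rule measurable_sets) simp
  also have "X n -` ({x} \<inter> S) \<inter> space M = {\<omega> \<in> space M. X n \<omega> = x}"
    using markov_chain_in_states by auto
  finally show ?thesis .
qed

text \<open>The chain property conditions on complete histories. Splitting the event that
  \<open>X n\<close> equals \<open>x\<close> into the finitely many histories ending in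
  \<open>x\<close> and summing over them leaves a condition on the present state only.\<close>

lemma markov_chain_joint_prob:
  assumes "y \<in> S"
  shows "prob {\<omega> \<in> space M. X n \<omega> = x \<and> X (Suc n) \<omega> = y}
           = prob {\<omega> \<in> space M. X n \<omega> = x} * pmf (K x) y"
proof -
  \<comment> \<open>Histories are extensional functions, so there are finitely many of them and two
    different ones disagree at some index at most \<open>n\<close>.\<close>
  define H where "H = {s \<in> PiE {..n} (\<lambda>_. S). s n = x}"
  define A where "A s = {\<omega> \<in> space M. \<forall>i\<le>n. X i \<omega> = s i}" for s
  define E where "E = {\<omega> \<in> space M. X (Suc n) \<omega> = y}"
  have fin: "finite H"
    unfolding H_def by (rule finite_subset[of _ "PiE {..n} (\<lambda>_. S)"]) (auto simp: finite_states finite_PiE)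
  have E_sets: "E \<in> sets M"
    unfolding E_def by (rule markov_chain_state_sets)
  have A_sets: "A s \<in> sets M" for s
  proof -
    have "{\<omega> \<in> space M. \<forall>i\<in>{..n}. X i \<omega> = s i} \<in> sets M"
      by (intro sets.sets_Collect_finite_All markov_chain_state_sets) simp
    then show ?thesis
      unfolding A_def Ball_def atMost_iff .
  qed
  have disj: "disjoint_family_on A H"
    unfolding disjoint_family_on_def
  proof (intro ballI impI)
    fix s s' assume s: "s \<in> H" "s' \<in> H" "s \<noteq> s'"
    then obtain i where "i \<le> n" "s i \<noteq> s' i"
      unfolding H_def using PiE_ext[of s "{..n}" "\<lambda>_. S" s'] by auto
    then show "A s \<inter> A s' = {}"
      by (auto simp: A_def)
  qed
  have ex: "\<exists>s\<in>H. \<omega> \<in> A s" if "\<omega> \<in> space M" "X n \<omega> = x" for \<omega>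
    using that markov_chain_in_states
    by (intro bexI[of _ "restrict (\<lambda>i. X i \<omega>) {..n}"]) (auto simp: H_def A_def)
  have A_Un: "{\<omega> \<in> space M. X n \<omega> = x} = (\<Union>s\<in>H. A s)"
    using ex by (auto simp: A_def H_def)
  have B_Un: "{\<omega> \<in> space M. X n \<omega> = x \<and> X (Suc n) \<omega> = y} = (\<Union>s\<in>H. A s \<inter> E)"
    using ex by (auto simp: A_def H_def E_def)
  \<comment> \<open>The transition law is given only after histories of positive probability; for a
    null history both sides are \<open>0\<close>.\<close>
  have step: "prob (A s \<inter> E) = prob (A s) * pmf (K x) y" if "s \<in> H" for s
  proof (cases "prob (A s) > 0")
    case True
    then have "\<P>(\<omega> in M. X (Suc n) \<omega> = y \<bar> \<forall>i\<le>n. X i \<omega> = s i) = pmf (K (s n)) y"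
      using chain assms unfolding markov_chain_def A_def by blast
    moreover have "{\<omega> \<in> space M. X (Suc n) \<omega> = y \<and> (\<forall>i\<le>n. X i \<omega> = s i)} = A s \<inter> E"
      by (auto simp: A_def E_def)
    ultimately show ?thesis
      using True that by (simp add: cond_prob_def A_def[symmetric] H_def field_simps)
  next
    case False
    then have "prob (A s) = 0"
      by (simp add: zero_less_measure_iff)
    moreover have "prob (A s \<inter> E) \<le> prob (A s)"
      by (rule finite_measure_mono) (auto simp: A_sets)
    ultimately show ?thesis
      by (simp add: measure_le_0_iff)
  qed
  have "prob (\<Union>s\<in>H. A s \<inter> E) = (\<Sum>s\<in>H. prob (A s \<inter> E))"
    using A_sets E_sets disj
    by (intro finite_measure_finite_Union fin) (auto simp: disjoint_family_on_def)
  also have "\<dots> = (\<Sum>s\<in>H. prob (A s)) * pmf (K x) y"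
    by (simp add: step sum_distrib_right)
  also have "(\<Sum>s\<in>H. prob (A s)) = prob (\<Union>s\<in>H. A s)"
    using A_sets disj by (intro finite_measure_finite_Union[symmetric] fin) auto
  finally show ?thesis
    by (simp add: A_Un B_Un)
qed

lemma markov_chain_prob_Suc:
  assumes "y \<in> S"
  shows "prob {\<omega> \<in> space M. X (Suc n) \<omega> = y}
           = (\<Sum>x\<in>S. prob {\<omega> \<in> space M. X n \<omega> = x} * pmf (K x) y)"
proof -
  have "{\<omega> \<in> space M. X (Suc n) \<omega> = y} = (\<Union>x\<in>S. {\<omega> \<in> space M. X n \<omega> = x \<and> X (Suc n) \<omega> = y})"
    using markov_chain_in_states by auto
  also have "prob \<dots> = (\<Sum>x\<in>S. prob {\<omega> \<in> space M. X n \<omega> = x \<and> X (Suc n) \<omega> = y})"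
    by (intro finite_measure_finite_Union finite_states)
      (auto simp: disjoint_family_on_def intro!: sets.sets_Collect_conj markov_chain_state_sets)
  finally show ?thesis
    by (simp add: markov_chain_joint_prob assms)
qed

text \<open>With finitely many states, \<open>f (X n \<omega>)\<close> is a finite combination of
  indicators, so integrability and the value of the mean come together.\<close>

lemma markov_chain_has_expectation:
  fixes f :: "'s \<Rightarrow> real"
  shows "has_bochner_integral M (\<lambda>\<omega>. f (X n \<omega>)) (\<Sum>x\<in>S. f x * prob {\<omega> \<in> space M. X n \<omega> = x})"
proof -
  have "has_bochner_integral M
          (\<lambda>\<omega>. \<Sum>x\<in>S. f x * indicator {\<omega> \<in> space M. X n \<omega> = x} \<omega>)
          (\<Sum>x\<in>S. f x * prob {\<omega> \<in> space M. X n \<omega> = x})"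
    by (intro has_bochner_integral_sum has_bochner_integral_mult_right
        has_bochner_integral_real_indicator markov_chain_state_sets) (simp add: emeasure_eq_measure)
  moreover have "(\<Sum>x\<in>S. f x * indicator {\<omega> \<in> space M. X n \<omega> = x} \<omega>) = f (X n \<omega>)"
    if "\<omega> \<in> space M" for \<omega>
    using that markov_chain_in_states[OF that, of n] finite_states
    by (simp add: indicator_def sum.delta if_distrib[where f = "\<lambda>c. _ * c"] cong: if_cong)
  ultimately show ?thesis
    by (subst has_bochner_integral_cong) (auto simp: )
qed

text \<open>A statewise bound for the kernel is averaged over the law of \<open>X n\<close>. In this
  form the Markov property enters the second moment recursion.\<close>

lemma markov_chain_expectation_Suc_le:
  fixes f g :: "'s \<Rightarrow> real"
  assumes "\<And>x. x \<in> S \<Longrightarrow> (\<Sum>y\<in>S. pmf (K x) y * f y) \<le> g x"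
  shows "expectation (\<lambda>\<omega>. f (X (Suc n) \<omega>)) \<le> expectation (\<lambda>\<omega>. g (X n \<omega>))"
proof -
  let ?q = "\<lambda>n x. prob {\<omega> \<in> space M. X n \<omega> = x}"
  have "expectation (\<lambda>\<omega>. f (X (Suc n) \<omega>)) = (\<Sum>y\<in>S. f y * ?q (Suc n) y)"
    by (rule has_bochner_integral_integral_eq[OF markov_chain_has_expectation])
  also have "\<dots> = (\<Sum>y\<in>S. \<Sum>x\<in>S. ?q n x * (pmf (K x) y * f y))"
    by (simp add: markov_chain_prob_Suc sum_distrib_left mult_ac)
  also have "\<dots> = (\<Sum>x\<in>S. ?q n x * (\<Sum>y\<in>S. pmf (K x) y * f y))"
    by (subst sum.swap) (simp add: sum_distrib_left)
  also have "\<dots> \<le> (\<Sum>x\<in>S. ?q n x * g x)"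
    by (intro sum_mono mult_left_mono assms) auto
  also have "\<dots> = expectation (\<lambda>\<omega>. g (X n \<omega>))"
    by (simp add: has_bochner_integral_integral_eq[OF markov_chain_has_expectation] mult_ac)
  finally show ?thesis .
qed

text \<open>Each forbidden transition between two states has probability \<open>0\<close>, and only
  finitely many pairs of states and countably many times have to be excluded.\<close>

lemma markov_chain_AE_step:
  assumes "\<And>x y. x \<in> S \<Longrightarrow> y \<in> set_pmf (K x) \<Longrightarrow> R x y"
  shows "AE \<omega> in M. \<forall>n. R (X n \<omega>) (X (Suc n) \<omega>)"
  unfolding AE_all_countable
proof
  fix n
  have null: "AE \<omega> in M. \<not> (X n \<omega> = x \<and> X (Suc n) \<omega> = y)"
    if "x \<in> S" "y \<in> S" "\<not> R x y" for x y
  proof (rule AE_I')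
    have "pmf (K x) y = 0"
      using that assms by (metis pmf_eq_0_set_pmf)
    then have "prob {\<omega> \<in> space M. X n \<omega> = x \<and> X (Suc n) \<omega> = y} = 0"
      using that by (simp add: markov_chain_joint_prob)
    then show "{\<omega> \<in> space M. X n \<omega> = x \<and> X (Suc n) \<omega> = y} \<in> null_sets M"
      by (auto simp: null_sets_def emeasure_eq_measure
          intro!: sets.sets_Collect_conj markov_chain_state_sets)
  qed auto
  have "AE \<omega> in M. \<forall>x\<in>S. \<forall>y\<in>S. \<not> R x y \<longrightarrow> \<not> (X n \<omega> = x \<and> X (Suc n) \<omega> = y)"
    using null by (auto intro!: AE_finite_allI finite_states)
  then show "AE \<omega> in M. R (X n \<omega>) (X (Suc n) \<omega>)"
    using AE_space by eventually_elim (use markov_chain_in_states in blast)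
qed

end

subsection \<open>The limiting differential equation\<close>

text \<open>The conditions \<open>drift_nonneg\<close> and \<open>drift_one\<close> are consequences
  of the approximation of the means, proved in \<open>limit_drift_nonneg\<close> and
  \<open>limit_drift_one\<close>. With the Lipschitz bound they keep the slope of \<open>z\<close>
  between \<open>1\<close> and \<open>1 + L\<close> while \<open>z\<close> is at most
  \<open>1\<close>.\<close>

locale fluid_limit =
  fixes \<gamma> z :: "real \<Rightarrow> real" and L :: real
  assumes lipschitz: "L-lipschitz_on {0..} \<gamma>"
    and drift_nonneg: "\<And>u. 0 \<le> u \<Longrightarrow> u \<le> 1 \<Longrightarrow> 0 \<le> \<gamma> u"
    and drift_one: "\<gamma> 1 = 0"
    and ivp: "solves_ivp_nonneg (\<lambda>u. 1 + \<gamma> u) z 0"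
begin

lemma L_nonneg: "0 \<le> L"
  using lipschitz by (rule lipschitz_on_nonneg)

lemma drift_lipschitz: "0 \<le> u \<Longrightarrow> 0 \<le> v \<Longrightarrow> \<bar>\<gamma> u - \<gamma> v\<bar> \<le> L * \<bar>u - v\<bar>"
  using lipschitz_onD[OF lipschitz, of u v] by (simp add: dist_real_def)

lemma drift_le:
  assumes "0 \<le> u" "u \<le> 1"
  shows "\<gamma> u \<le> L"
proof -
  have "\<gamma> u \<le> L * (1 - u)"
    using drift_lipschitz[of u 1] assms drift_one by simp
  also have "\<dots> \<le> L * 1"
    using assms L_nonneg by (intro mult_left_mono) auto
  finally show ?thesis by simp
qed

lemma z_nonneg: "0 \<le> t \<Longrightarrow> 0 \<le> z t"
  and z_0: "z 0 = 0"
  and z_deriv: "0 \<le> t \<Longrightarrow> (z has_real_derivative 1 + \<gamma> (z t)) (at t within {0..})"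
  using ivp by (auto simp: solves_ivp_nonneg_def)

lemma z_mean_value:
  assumes "0 \<le> s" "s < t"
  obtains \<xi> where "s < \<xi>" "\<xi> < t" "z t - z s = (t - s) * (1 + \<gamma> (z \<xi>))"
proof -
  have "(z has_derivative (*) (1 + \<gamma> (z r))) (at r within {s..t})" if "s \<le> r" for r
    using z_deriv[of r] that assms
    by (auto simp: has_field_derivative_def intro: has_derivative_subset)
  then have "\<exists>\<xi>\<in>{s<..<t}. z t - z s = (1 + \<gamma> (z \<xi>)) * (t - s)"
    using assms by (intro mvt_simple) auto
  then show ?thesis
    using that by (auto simp: mult_ac)
qed

lemma z_continuous: "continuous_on {0..} z"
  unfolding continuous_on_eq_continuous_within
  using z_deriv DERIV_continuous by (metis atLeast_iff)

lemma z_increases_below_one: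
  assumes "0 \<le> s" "s < t" "\<And>r. s < r \<Longrightarrow> r < t \<Longrightarrow> z r \<le> 1"
  shows "t - s \<le> z t - z s"
proof -
  obtain \<xi> where \<xi>: "s < \<xi>" "\<xi> < t" "z t - z s = (t - s) * (1 + \<gamma> (z \<xi>))"
    using z_mean_value[OF assms(1,2)] .
  have "0 \<le> \<gamma> (z \<xi>)"
    using \<xi> assms by (intro drift_nonneg z_nonneg) auto
  then have "(t - s) * 1 \<le> (t - s) * (1 + \<gamma> (z \<xi>))"
    using assms by (intro mult_left_mono) auto
  then show ?thesis using \<xi> by simp
qed

text \<open>After the last time in \<open>{s..t}\<close> at which \<open>z\<close> is at least
  \<open>1\<close>, the solution would lie below \<open>1\<close>; there it increases, so it could
  not end below \<open>1\<close>. That last time is attained because \<open>C\<close> is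
  closed.\<close>

lemma z_stays_above_one:
  assumes "0 \<le> s" "s \<le> t" "1 \<le> z s"
  shows "1 \<le> z t"
proof (rule ccontr)
  assume less: "\<not> 1 \<le> z t"
  define C where "C = {s..t} \<inter> z -` {1..}"
  have "continuous_on {s..t} z"
    using z_continuous assms by (rule_tac continuous_on_subset) auto
  then have "closed C"
    unfolding C_def by (rule continuous_closed_preimage) auto
  moreover have "s \<in> C" and bdd: "bdd_above C"
    using assms by (auto simp: C_def)
  ultimately have Sup: "Sup C \<in> C"
    by (intro closed_contains_Sup) auto
  then have "Sup C < t"
    using less by (cases "Sup C = t") (auto simp: C_def)
  moreover have "z r \<le> 1" if "Sup C < r" "r < t" for r
  proof (rule ccontr)
    assume "\<not> z r \<le> 1"
    then have "r \<in> C"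
      using that Sup by (auto simp: C_def)
    then show False
      using cSup_upper[OF _ bdd, of r] that by simp
  qed
  ultimately have "t - Sup C \<le> z t - z (Sup C)"
    using Sup assms by (intro z_increases_below_one) (auto simp: C_def)
  then show False
    using less Sup \<open>Sup C < t\<close> by (simp add: C_def)
qed

text \<open>The derivative at a hitting time of \<open>1\<close> is \<open>1 + \<gamma> 1 > 0\<close>, so \<open>z\<close> cannot come down to \<open>1\<close>
  from above.\<close>

lemma z_le_one_before:
  assumes "0 \<le> s" "s \<le> t" "z t \<le> 1"
  shows "z s \<le> 1"
proof (rule ccontr)
  assume gt: "\<not> z s \<le> 1"
  then have "s < t"
    using assms by (cases "s = t") auto
  have "z t = 1"
    using z_stays_above_one[of s t] gt assms by auto
  then have "(z has_real_derivative 1) (at t within {0..})"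
    using z_deriv[of t] assms by (simp add: drift_one)
  then obtain d where d: "d > 0" "\<And>h. h > 0 \<Longrightarrow> t - h \<in> {0..} \<Longrightarrow> h < d \<Longrightarrow> z (t - h) < z t"
    using has_real_derivative_pos_inc_left[of z 1 t "{0..}"] by auto
  \<comment> \<open>Halving \<open>d\<close> makes \<open>h < d\<close> strict; the other bound
    keeps \<open>t - h\<close> at or after \<open>s\<close>, where \<open>z_stays_above_one\<close>
    contradicts the strict decrease backwards from \<open>t\<close>.\<close>
  define h where "h = min (d / 2) (t - s)"
  have h: "0 < h" "h < d" "h \<le> t - s"
    unfolding h_def using \<open>d > 0\<close> \<open>s < t\<close> by linarith+
  have "t - h \<in> {0..}"
    unfolding atLeast_iff using h(3) assms(1) by linarith
  then have "z (t - h) < z t"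
    by (rule d(2)[OF h(1) _ h(2)])
  moreover have "1 \<le> z (t - h)"
  proof (rule z_stays_above_one[OF assms(1)])
    show "s \<le> t - h" "1 \<le> z s"
      using h(3) gt by linarith+
  qed
  ultimately show False using \<open>z t = 1\<close> by simp
qed

section \<open>The solution stopped at 1 and its one-step error estimates\<close>

abbreviation w :: "real \<Rightarrow> real" where
  "w t \<equiv> min (z t) 1"

text \<open>Replaces an increment of \<open>w\<close> by an increment of \<open>z\<close> over a
  possibly shorter interval on which \<open>z\<close> is at most \<open>1\<close>; if
  \<open>z\<close> crosses \<open>1\<close>, the intermediate value theorem supplies
  \<open>r\<close>.\<close>

lemma w_hitting_time:
  assumes "0 \<le> s" "s \<le> t" "z s \<le> 1"
  obtains r where "s \<le> r" "r \<le> t" "z r \<le> 1" "w t = z r"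
proof (cases "z t \<le> 1")
  case True
  then show ?thesis using that[of t] assms by simp
next
  case False
  have "continuous_on {s..t} z"
    using z_continuous assms by (rule_tac continuous_on_subset) auto
  then obtain r where "s \<le> r" "r \<le> t" "z r = 1"
    using IVT'[of z s 1 t] assms False by auto
  then show ?thesis using that[of r] False by simp
qed

text \<open>All three bounds come from the mean value theorem. For the last one, the slopes at
  \<open>\<xi>\<close> and at \<open>s\<close> differ by at most \<open>L\<close> times the
  increment of \<open>z\<close>, which is itself at most \<open>(t - s) * (1 + L)\<close>.\<close>

lemma z_growth_bounds:
  assumes "0 \<le> s" "s \<le> t" "z t \<le> 1"
  shows "0 \<le> z t - z s" "z t - z s \<le> (t - s) * (1 + L)"
    and "\<bar>z t - z s - (t - s) * (1 + \<gamma> (z s))\<bar> \<le> L * (1 + L) * (t - s)\<^sup>2"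
proof -
  \<comment> \<open>Stated for all subintervals because the remainder estimate needs it on the
    interval from \<open>s\<close> to \<open>\<xi>\<close>.\<close>
  have main: "0 \<le> z b - z a \<and> z b - z a \<le> (b - a) * (1 + L)" if "s \<le> a" "a \<le> b" "b \<le> t" for a b
  proof (cases "a = b")
    case False
    then obtain \<xi> where \<xi>: "a < \<xi>" "\<xi> < b" "z b - z a = (b - a) * (1 + \<gamma> (z \<xi>))"
      using z_mean_value[of a b] assms \<open>s \<le> a\<close> \<open>a \<le> b\<close> by auto
    have "0 \<le> z \<xi>" "z \<xi> \<le> 1"
      using \<xi> assms that by (auto intro: z_nonneg z_le_one_before[of \<xi> t])
    then show ?thesis
      unfolding \<xi>(3) using \<xi> drift_nonneg[of "z \<xi>"] drift_le[of "z \<xi>"]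
      by (auto intro!: mult_left_mono mult_nonneg_nonneg)
  qed simp
  from main[of s t] assms show "0 \<le> z t - z s" "z t - z s \<le> (t - s) * (1 + L)" by auto
  show "\<bar>z t - z s - (t - s) * (1 + \<gamma> (z s))\<bar> \<le> L * (1 + L) * (t - s)\<^sup>2"
  proof (cases "s = t")
    case False
    then obtain \<xi> where \<xi>: "s < \<xi>" "\<xi> < t" "z t - z s = (t - s) * (1 + \<gamma> (z \<xi>))"
      using z_mean_value[of s t] assms by auto
    have "\<bar>\<gamma> (z \<xi>) - \<gamma> (z s)\<bar> \<le> L * \<bar>z \<xi> - z s\<bar>"
      using \<xi> assms by (intro drift_lipschitz z_nonneg) auto
    also have "\<dots> \<le> L * ((\<xi> - s) * (1 + L))"
      using main[of s \<xi>] \<xi> L_nonneg by (intro mult_left_mono) auto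
    also have "\<dots> \<le> L * ((t - s) * (1 + L))"
      using \<xi> L_nonneg by (intro mult_left_mono mult_right_mono) auto
    finally have "(t - s) * \<bar>\<gamma> (z \<xi>) - \<gamma> (z s)\<bar> \<le> (t - s) * (L * ((t - s) * (1 + L)))"
      using assms by (intro mult_left_mono) auto
    moreover have "z t - z s - (t - s) * (1 + \<gamma> (z s)) = (t - s) * (\<gamma> (z \<xi>) - \<gamma> (z s))"
      unfolding \<xi>(3) by (simp add: algebra_simps)
    then have "\<bar>z t - z s - (t - s) * (1 + \<gamma> (z s))\<bar> = (t - s) * \<bar>\<gamma> (z \<xi>) - \<gamma> (z s)\<bar>"
      using assms by (simp add: abs_mult)
    ultimately show ?thesis
      by (simp add: power2_eq_square mult_ac)
  qed simp
qed

lemma w_nonneg: "0 \<le> t \<Longrightarrow> 0 \<le> w t"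
  by (simp add: z_nonneg)

lemma w_growth:
  assumes "0 \<le> s" "s \<le> t"
  shows "0 \<le> w t - w s" "w t - w s \<le> (t - s) * (1 + L)"
proof -
  have "0 \<le> w t - w s \<and> w t - w s \<le> (t - s) * (1 + L)"
  proof (cases "z s \<le> 1")
    case True
    then obtain r where r: "s \<le> r" "r \<le> t" "z r \<le> 1" "w t = z r"
      using w_hitting_time[OF assms] by blast
    have "(r - s) * (1 + L) \<le> (t - s) * (1 + L)"
      using r L_nonneg by (intro mult_right_mono) auto
    then show ?thesis
      using z_growth_bounds[of s r] r assms True by simp
  next
    case False
    then show ?thesis
      using z_stays_above_one[of s t] assms L_nonneg by simp
  qed
  then show "0 \<le> w t - w s" "w t - w s \<le> (t - s) * (1 + L)" by auto
qed

text \<open>Remains valid if \<open>z\<close> crosses \<open>1\<close> during the step: stopping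
  shortens the interval to \<open>{s..r}\<close>, and since \<open>1 + \<gamma> (w s)\<close> is
  nonnegative, extending it to \<open>t\<close> only enlarges the bound. The corresponding lower
  bound requires that no crossing has taken place by time \<open>t\<close>.\<close>

lemma w_step_upper:
  assumes "0 \<le> s" "s \<le> t" "z s \<le> 1"
  shows "w t - w s \<le> (t - s) * (1 + \<gamma> (w s)) + L * (1 + L) * (t - s)\<^sup>2"
proof -
  obtain r where r: "s \<le> r" "r \<le> t" "z r \<le> 1" "w t = z r"
    using w_hitting_time[OF assms] by blast
  have "w t - w s \<le> (r - s) * (1 + \<gamma> (z s)) + L * (1 + L) * (r - s)\<^sup>2"
    using z_growth_bounds(3)[of s r] r assms by (auto simp: abs_le_iff)
  also have "\<dots> \<le> (t - s) * (1 + \<gamma> (z s)) + L * (1 + L) * (t - s)\<^sup>2"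
    using r assms L_nonneg drift_nonneg[of "z s"] z_nonneg[of s]
    by (intro add_mono mult_left_mono mult_right_mono power_mono) auto
  finally show ?thesis using assms by simp
qed

lemma w_step_lower:
  assumes "0 \<le> s" "s \<le> t" "z t \<le> 1"
  shows "w t - w s \<ge> (t - s) * (1 + \<gamma> (w s)) - L * (1 + L) * (t - s)\<^sup>2"
  using z_growth_bounds(3)[of s t] z_le_one_before[of s t] assms by (auto simp: abs_le_iff)

text \<open>The discretisation error is of first order in \<open>h\<close> only for the step in which \<open>w\<close> reaches \<open>1\<close>;
  there a deviation \<open>u > w s\<close> is itself of order \<open>h\<close>.\<close>

lemma one_sided_step:
  assumes "0 \<le> s" "0 \<le> h" "0 \<le> u" "u < 1" "0 \<le> m" "\<bar>m - \<gamma> u\<bar> \<le> \<delta>"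
  shows "(u - w s) * (h * (1 + m) - (w (s + h) - w s))
           \<le> h * (L * (u - w s)\<^sup>2 + \<delta> + h * (1 + L + \<delta>)\<^sup>2)"
proof -
  define d where "d = u - w s"
  define a where "a = h * (1 + m) - (w (s + h) - w s)"
  \<comment> \<open>One constant that dominates both the Taylor constant \<open>L * (1 + L)\<close>
    and the product \<open>(1 + L) * (1 + L + \<delta>)\<close> from the crossing step.\<close>
  define C where "C = (1 + L + \<delta>)\<^sup>2"
  have "0 \<le> \<delta>" using assms by linarith
  note [simp] = L_nonneg
  have C: "L * (1 + L) \<le> C" "(1 + L) * (1 + L + \<delta>) \<le> C" "0 \<le> C"
    unfolding C_def power2_eq_square using \<open>0 \<le> \<delta>\<close> by (auto intro!: mult_mono)
  have w: "0 \<le> w s" "w s \<le> 1" using assms w_nonneg by auto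
  have d_le: "\<bar>d\<bar> \<le> 1" using w assms by (auto simp: d_def)
  have lip: "\<bar>\<gamma> u - \<gamma> (w s)\<bar> \<le> L * \<bar>d\<bar>"
    unfolding d_def using assms w by (intro drift_lipschitz) auto
  have diff: "\<bar>m - \<gamma> (w s)\<bar> \<le> L * \<bar>d\<bar> + \<delta>" using lip assms by linarith
  have a_le: "a \<le> h * (1 + L + \<delta>)"
  proof -
    have "a \<le> h * (1 + m)" using w_growth[of s "s + h"] assms by (simp add: a_def)
    also have "\<dots> \<le> h * (1 + L + \<delta>)"
      using drift_le[of u] assms by (intro mult_left_mono) auto
    finally show ?thesis .
  qed
  \<comment> \<open>Sufficient whenever the relevant one-sided error of \<open>a\<close> is of
    second order; \<open>\<bar>d\<bar> \<le> 1\<close> absorbs the factor in front of the terms not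
    containing \<open>L * \<bar>d\<bar>\<close>.\<close>
  have smooth: ?thesis if "d * a \<le> \<bar>d\<bar> * (h * (L * \<bar>d\<bar> + \<delta>) + L * (1 + L) * h\<^sup>2)"
  proof -
    have "\<bar>d\<bar> * (h * \<delta>) \<le> 1 * (h * \<delta>)" "\<bar>d\<bar> * (L * (1 + L) * h\<^sup>2) \<le> 1 * (C * h\<^sup>2)"
      using d_le assms C \<open>0 \<le> \<delta>\<close> by (intro mult_mono; simp)+
    moreover have "\<bar>d\<bar> * (h * (L * \<bar>d\<bar>)) = h * (L * d\<^sup>2)"
      by (simp add: power2_eq_square abs_mult_self_eq algebra_simps)
    ultimately have "d * a \<le> h * (L * d\<^sup>2 + \<delta> + h * C)"
      using that by (simp add: algebra_simps power2_eq_square)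
    then show ?thesis by (simp add: d_def a_def C_def)
  qed
  consider "1 < z s" | "z s \<le> 1" "d \<le> 0" | "z s \<le> 1" "0 \<le> d" "z (s + h) \<le> 1"
    | "z s \<le> 1" "0 \<le> d" "1 < z (s + h)"
    by linarith
  then show ?thesis
  proof cases
    \<comment> \<open>Here \<open>w\<close> rests at \<open>1\<close> above \<open>u\<close> while
      the chain still moves up, so the product has the favourable sign.\<close>
    case 1
    then have "d \<le> 0" "0 \<le> a"
      using z_stays_above_one[of s "s + h"] assms by (auto simp: d_def a_def)
    then have "d * a \<le> 0" by (simp add: mult_nonpos_nonneg)
    also have "0 \<le> h * (L * d\<^sup>2 + \<delta> + h * C)"
      using assms \<open>0 \<le> \<delta>\<close> C by simp
    finally show ?thesis by (simp add: d_def a_def C_def)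
  next
    \<comment> \<open>As \<open>d \<le> 0\<close>, only a lower bound on \<open>a\<close> matters,
      and \<open>w_step_upper\<close> gives it whether or not \<open>1\<close> is crossed.\<close>
    case 2
    have "- a = (w (s + h) - w s) - h * (1 + m)" by (simp add: a_def)
    also have "\<dots> \<le> h * (1 + \<gamma> (w s)) + L * (1 + L) * h\<^sup>2 - h * (1 + m)"
      using w_step_upper[of s "s + h"] assms 2 by simp
    also have "\<dots> = h * (\<gamma> (w s) - m) + L * (1 + L) * h\<^sup>2"
      by (simp add: algebra_simps)
    also have "\<dots> \<le> h * (L * \<bar>d\<bar> + \<delta>) + L * (1 + L) * h\<^sup>2"
      using diff assms(2) by (intro add_right_mono mult_left_mono) linarith+
    finally have "\<bar>d\<bar> * - a \<le> \<bar>d\<bar> * (h * (L * \<bar>d\<bar> + \<delta>) + L * (1 + L) * h\<^sup>2)"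
      by (rule mult_left_mono) simp
    then show ?thesis using 2 by (intro smooth) simp
  next
    case 3
    have "a \<le> h * (1 + m) - (h * (1 + \<gamma> (w s)) - L * (1 + L) * h\<^sup>2)"
      using w_step_lower[of s "s + h"] assms 3 by (simp add: a_def)
    also have "\<dots> = h * (m - \<gamma> (w s)) + L * (1 + L) * h\<^sup>2"
      by (simp add: algebra_simps)
    also have "\<dots> \<le> h * (L * \<bar>d\<bar> + \<delta>) + L * (1 + L) * h\<^sup>2"
      using diff assms(2) by (intro add_right_mono mult_left_mono) linarith+
    finally have "\<bar>d\<bar> * a \<le> \<bar>d\<bar> * (h * (L * \<bar>d\<bar> + \<delta>) + L * (1 + L) * h\<^sup>2)"
      by (rule mult_left_mono) simp
    then show ?thesis using 3 by (intro smooth) simp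
  next
    \<comment> \<open>Only a first-order bound on \<open>a\<close> is available, but
      \<open>u < 1 = w (s + h)\<close> bounds \<open>d\<close> by the increment of \<open>w\<close>,
      so the product is again of second order.\<close>
    case 4
    have "d \<le> h * (1 + L)"
      using w_growth[of s "s + h"] assms 4 by (simp add: d_def)
    then have "d * a \<le> (h * (1 + L)) * (h * (1 + L + \<delta>))"
      using 4(2) a_le assms(2) \<open>0 \<le> \<delta>\<close> mult_left_mono[OF a_le, of d]
        mult_right_mono[of d "h * (1 + L)" "h * (1 + L + \<delta>)"] by simp
    also have "\<dots> = h * (h * ((1 + L) * (1 + L + \<delta>)))"
      by (simp add: algebra_simps)
    also have "\<dots> \<le> h * (h * C)"
      using assms(2) C by (intro mult_left_mono) auto
    also have "\<dots> \<le> h * (L * d\<^sup>2 + \<delta> + h * C)"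
      using assms(2) \<open>0 \<le> \<delta>\<close> by (intro mult_left_mono) auto
    finally show ?thesis by (simp add: d_def a_def C_def)
  qed
qed

text \<open>Expand the square of \<open>(u - w s) + a\<close>. The doubled cross term contributes
  two copies of \<open>h\<^sup>2 * (1 + L + \<delta>)\<^sup>2\<close> and \<open>a\<^sup>2\<close> a
  third one, whence the factor \<open>3\<close>.\<close>

lemma square_step:
  assumes "0 \<le> s" "0 \<le> h" "0 \<le> u" "u < 1" "0 \<le> m" "\<bar>m - \<gamma> u\<bar> \<le> \<delta>"
  shows "(u + h * (1 + m) - w (s + h))\<^sup>2
           \<le> (1 + 2 * L * h) * (u - w s)\<^sup>2 + h * (2 * \<delta> + 3 * h * (1 + L + \<delta>)\<^sup>2)"
proof -
  define a where "a = h * (1 + m) - (w (s + h) - w s)"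
  have "0 \<le> \<delta>" using assms by linarith
  have "h * (1 + m) \<le> h * (1 + L + \<delta>)"
    using drift_le[of u] assms by (intro mult_left_mono) auto
  moreover have "w (s + h) - w s \<le> h * (1 + L + \<delta>)"
    using w_growth(2)[of s "s + h"] assms mult_left_mono[of "1 + L" "1 + L + \<delta>" h] \<open>0 \<le> \<delta>\<close>
    by simp
  moreover have "0 \<le> h * (1 + m)" "0 \<le> w (s + h) - w s"
    using w_growth(1)[of s "s + h"] assms by auto
  ultimately have "\<bar>a\<bar> \<le> h * (1 + L + \<delta>)" unfolding a_def by linarith
  then have "a\<^sup>2 \<le> (h * (1 + L + \<delta>))\<^sup>2"
    by (metis abs_ge_zero power2_abs power_mono)
  then have "a\<^sup>2 \<le> h\<^sup>2 * (1 + L + \<delta>)\<^sup>2"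
    by (simp only: power_mult_distrib)
  moreover have "(u + c - y)\<^sup>2 = (u - x)\<^sup>2 + 2 * ((u - x) * (c - (y - x))) + (c - (y - x))\<^sup>2"
    for x y c :: real
    by (simp add: power2_eq_square algebra_simps)
  then have "(u + h * (1 + m) - w (s + h))\<^sup>2 = (u - w s)\<^sup>2 + 2 * ((u - w s) * a) + a\<^sup>2"
    unfolding a_def by blast
  moreover have "(u - w s) * a \<le> h * (L * (u - w s)\<^sup>2 + \<delta> + h * (1 + L + \<delta>)\<^sup>2)"
    unfolding a_def using one_sided_step[OF assms] .
  moreover have "E \<le> (1 + 2 * L * h) * D + h * (2 * \<delta> + 3 * h * C)"
    if "b \<le> h\<^sup>2 * C" "E = D + 2 * A + b" "A \<le> h * (L * D + \<delta> + h * C)" for A b C D E :: real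
    using that by (simp add: algebra_simps power2_eq_square)
  ultimately show ?thesis
    by blast
qed

end

subsection \<open>The exploration chain\<close>

lemma exploration_kernel_expectation:
  fixes f :: "nat \<Rightarrow> real"
  assumes "x < N" "set_pmf (p N x) \<subseteq> {0..N - x - 1}"
  shows "(\<Sum>y\<in>{0..N}. pmf (exploration_kernel p N x) y * f y)
           = (\<Sum>k<N. pmf (p N x) k * f (x + k + 1))"
proof -
  have "(\<Sum>y\<in>{0..N}. f y * pmf (exploration_kernel p N x) y)
          = measure_pmf.expectation (exploration_kernel p N x) f"
    using assms by (intro integral_measure_pmf_real[symmetric]) (auto simp: exploration_kernel_def)
  also have "\<dots> = measure_pmf.expectation (p N x) (\<lambda>k. f (x + k + 1))"
    using assms by (simp add: exploration_kernel_def)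
  also have "\<dots> = (\<Sum>k<N. f (x + k + 1) * pmf (p N x) k)"
    using assms by (intro integral_measure_pmf_real) auto
  finally show ?thesis
    by (simp add: mult.commute)
qed

text \<open>Bias-variance decomposition of one step: the cross term vanishes because
  \<open>real k - \<mu>\<close> is centred.\<close>

lemma exploration_kernel_second_moment:
  assumes "x < N" "set_pmf (p N x) \<subseteq> {0..N - x - 1}"
  shows "(\<Sum>y\<in>{0..N}. pmf (exploration_kernel p N x) y * (real y / real N - c)\<^sup>2)
           = (real x / real N + 1 / real N * (1 + nb_mean p N x) - c)\<^sup>2
             + nb_var p N x / (real N)\<^sup>2"
proof -
  define \<mu> where "\<mu> = nb_mean p N x"
  define a where "a = real x / real N + 1 / real N * (1 + \<mu>) - c"
  have "N > 0" using assms by simp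
  \<comment> \<open>By the support condition all mass lies in \<open>k < N\<close>, so the truncated
    sums are the full moments.\<close>
  have total: "(\<Sum>k<N. pmf (p N x) k) = 1"
    using assms by (intro sum_pmf_eq_1) auto
  have "(\<Sum>k<N. pmf (p N x) k * (real k - \<mu>)) = (\<Sum>k<N. real k * pmf (p N x) k) - \<mu> * (\<Sum>k<N. pmf (p N x) k)"
    by (simp add: sum_subtractf sum_distrib_left algebra_simps)
  then have centred: "(\<Sum>k<N. pmf (p N x) k * (real k - \<mu>)) = 0"
    by (simp add: total \<mu>_def nb_mean_def)
  have "(\<Sum>y\<in>{0..N}. pmf (exploration_kernel p N x) y * (real y / real N - c)\<^sup>2)
          = (\<Sum>k<N. pmf (p N x) k * (real (x + k + 1) / real N - c)\<^sup>2)"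
    using assms by (rule exploration_kernel_expectation)
  also have "\<dots> = (\<Sum>k<N. a\<^sup>2 * pmf (p N x) k + 2 * a / real N * (pmf (p N x) k * (real k - \<mu>))
                       + (real k - \<mu>)\<^sup>2 * pmf (p N x) k / (real N)\<^sup>2)"
  proof (rule sum.cong)
    fix k
    have "real (x + k + 1) / real N - c = a + (real k - \<mu>) / real N"
      using \<open>N > 0\<close> by (simp add: a_def field_simps)
    moreover have "q * (a + d / real N)\<^sup>2 = a\<^sup>2 * q + 2 * a / real N * (q * d) + d\<^sup>2 * q / (real N)\<^sup>2"
      for q d :: real
      by (simp add: power2_sum power_divide algebra_simps)
    ultimately show "pmf (p N x) k * (real (x + k + 1) / real N - c)\<^sup>2
        = a\<^sup>2 * pmf (p N x) k + 2 * a / real N * (pmf (p N x) k * (real k - \<mu>))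
          + (real k - \<mu>)\<^sup>2 * pmf (p N x) k / (real N)\<^sup>2"
      by simp
  qed simp
  also have "\<dots> = a\<^sup>2 * (\<Sum>k<N. pmf (p N x) k) + 2 * a / real N * (\<Sum>k<N. pmf (p N x) k * (real k - \<mu>))
                    + nb_var p N x / (real N)\<^sup>2"
    unfolding sum.distrib sum_distrib_left[symmetric] sum_divide_distrib[symmetric]
    by (simp add: nb_var_def \<mu>_def)
  finally show ?thesis
    unfolding total centred by (simp add: a_def \<mu>_def)
qed

lemma exploration_chain_bounds:
  assumes "exploration_chain p N M Z" "\<omega> \<in> space M"
  shows "0 \<le> scaled N Z t \<omega>" "scaled N Z t \<omega> \<le> 1"
proof -
  have "Z (nat \<lfloor>t * real N\<rfloor>) \<omega> \<in> {0..N}"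
    using assms markov_chain_in_states[of M "{0..N}"] by (auto simp: exploration_chain_def)
  then show "0 \<le> scaled N Z t \<omega>" "scaled N Z t \<omega> \<le> 1"
    by (auto simp: scaled_def divide_le_eq_1)
qed

lemma exploration_chain_mono:
  assumes "exploration_chain p N M Z"
  shows "AE \<omega> in M. \<forall>s t. s \<le> t \<longrightarrow> scaled N Z s \<omega> \<le> scaled N Z t \<omega>"
proof -
  have "AE \<omega> in M. \<forall>n. Z n \<omega> \<le> Z (Suc n) \<omega>"
    using assms unfolding exploration_chain_def
    by (intro markov_chain_AE_step[of M "{0..N}" "exploration_kernel p N"])
      (auto simp: exploration_kernel_def split: if_splits)
  then show ?thesis
  proof eventually_elim
    case (elim \<omega>)
    then have mono: "Z m \<omega> \<le> Z n \<omega>" if "m \<le> n" for m n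
      using that by (rule_tac lift_Suc_mono_le[of "\<lambda>n. Z n \<omega>"]) auto
    \<comment> \<open>Negative times are included: \<open>nat\<close> sends them to step
      \<open>0\<close>.\<close>
    have "nat \<lfloor>s * real N\<rfloor> \<le> nat \<lfloor>t * real N\<rfloor>" if "s \<le> t" for s t
      using that by (intro nat_mono floor_mono mult_right_mono) auto
    then show ?case
      by (auto simp: scaled_def intro!: divide_right_mono mono)
  qed
qed

text \<open>Passes from mean squares to means of absolute values, with \<open>\<eta>\<close> to be
  made small later; it is \<open>0 \<le> (\<bar>d\<bar> - \<eta>)\<^sup>2 + \<eta> *
  \<bar>d\<bar>\<close> divided by \<open>\<eta>\<close>.\<close>

lemma abs_le_add_square_div:
  fixes d \<eta> :: real
  assumes "0 < \<eta>"
  shows "\<bar>d\<bar> \<le> \<eta> + d\<^sup>2 / \<eta>"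
proof -
  have "0 \<le> (\<bar>d\<bar> - \<eta>)\<^sup>2 + \<eta> * \<bar>d\<bar>"
    using assms by simp
  then have "\<eta> * \<bar>d\<bar> \<le> \<eta> * \<eta> + d\<^sup>2"
    by (simp add: power2_eq_square algebra_simps)
  then show ?thesis
    using assms by (simp add: field_simps power2_eq_square)
qed

section \<open>Mean-square and uniform convergence of the scaled chain\<close>

context fluid_limit
begin

text \<open>Discrete Gronwall argument: \<open>square_step\<close> controls the squared conditional
  bias, the variance of a step adds at most \<open>\<psi> / N\<^sup>2\<close>, and the recursion
  starts from \<open>e 0 = 0\<close>.\<close>

lemma exploration_second_moment:
  assumes N: "N \<ge> 1" and chain: "exploration_chain p N M Z"
    and supp: "\<And>x. x < N \<Longrightarrow> set_pmf (p N x) \<subseteq> {0..N - x - 1}"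
    and mean: "\<And>x. x < N \<Longrightarrow> \<bar>nb_mean p N x - \<gamma> (real x / real N)\<bar> \<le> \<delta>"
    and var: "\<And>x. x < N \<Longrightarrow> nb_var p N x \<le> \<psi>"
  shows "(\<integral>\<omega>. (real (Z n \<omega>) / real N - w (real n / real N))\<^sup>2 \<partial>M)
           \<le> exp (2 * L * (real n / real N)) * (real n / real N)
               * (2 * \<delta> + 3 * (1 / real N) * (1 + L + \<delta>)\<^sup>2 + \<psi> / real N)"
proof -
  let ?h = "1 / real N"
  define \<epsilon> where "\<epsilon> = 2 * \<delta> + 3 * ?h * (1 + L + \<delta>)\<^sup>2 + \<psi> / real N"
  define f where "f n x = (real x / real N - w (real n / real N))\<^sup>2" for n x
  define e where "e n = (\<integral>\<omega>. f n (Z n \<omega>) \<partial>M)" for n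
  have mc: "markov_chain M {0..N} (exploration_kernel p N) Z"
    and init: "AE \<omega> in M. Z 0 \<omega> = 0"
    using chain by (auto simp: exploration_chain_def)
  interpret prob_space M
    using mc by (simp add: markov_chain_def)
  have "0 \<le> \<delta>"
    using mean[of 0] N by linarith
  have "0 \<le> nb_var p N 0"
    unfolding nb_var_def by (intro sum_nonneg) auto
  then have "0 \<le> \<psi>"
    using var[of 0] N by linarith
  have "0 \<le> \<epsilon>"
    unfolding \<epsilon>_def using \<open>0 \<le> \<delta>\<close> \<open>0 \<le> \<psi>\<close> by auto
  have kernel: "(\<Sum>y\<in>{0..N}. pmf (exploration_kernel p N x) y * f (Suc n) y)
                  \<le> (1 + 2 * L * ?h) * f n x + ?h * \<epsilon>" if "x \<in> {0..N}" for n x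
  proof (cases "x < N")
    case True
    have next_time: "real n / real N + ?h = real (Suc n) / real N"
      by (simp add: add_divide_distrib)
    have "0 \<le> nb_mean p N x"
      unfolding nb_mean_def by (intro sum_nonneg) auto
    then have "(real x / real N + ?h * (1 + nb_mean p N x) - w (real (Suc n) / real N))\<^sup>2
        \<le> (1 + 2 * L * ?h) * f n x + ?h * (2 * \<delta> + 3 * ?h * (1 + L + \<delta>)\<^sup>2)"
      unfolding f_def next_time[symmetric] using True mean[OF True]
      by (intro square_step) auto
    moreover have "nb_var p N x / (real N)\<^sup>2 \<le> ?h * (\<psi> / real N)"
      using var[OF True] by (simp add: power2_eq_square divide_right_mono)
    ultimately show ?thesis
      unfolding f_def[of "Suc n"] exploration_kernel_second_moment[where p = p, OF True supp[OF True]] \<epsilon>_def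
        ring_distribs by linarith
  next
    case False
    then have "x = N" using that by simp
    \<comment> \<open>In the absorbing state the scaled chain sits at \<open>1\<close>, and
      \<open>w\<close> can only approach \<open>1\<close> from below, so the distance does not
      grow.\<close>
    have "w (real n / real N) \<le> w (real (Suc n) / real N)"
      using w_growth(1)[of "real n / real N" "real (Suc n) / real N"]
      by (simp add: divide_right_mono)
    then have "f (Suc n) N \<le> f n N"
      unfolding f_def using N by (intro power_mono) auto
    also have "\<dots> \<le> (1 + 2 * L * ?h) * f n N"
      using mult_right_mono[of 1 "1 + 2 * L * ?h" "f n N"] L_nonneg by (simp add: f_def)
    also have "\<dots> \<le> (1 + 2 * L * ?h) * f n N + ?h * \<epsilon>"
      using \<open>0 \<le> \<epsilon>\<close> by simp
    moreover have "(\<Sum>y\<in>{0..N}. pmf (exploration_kernel p N N) y * f (Suc n) y) = f (Suc n) N"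
      by (simp add: exploration_kernel_def indicator_def sum.delta' if_distrib[where f = "\<lambda>c. c * _"] cong: if_cong)
    ultimately show ?thesis
      using \<open>x = N\<close> by simp
  qed
  have int: "integrable M (\<lambda>\<omega>. f n (Z n \<omega>))" for n
    using markov_chain_has_expectation[OF mc] by (auto simp: has_bochner_integral_iff)
  have rec: "e (Suc n) \<le> (1 + 2 * L * ?h) * e n + ?h * \<epsilon>" for n
  proof -
    have "e (Suc n) \<le> (\<integral>\<omega>. (1 + 2 * L * ?h) * f n (Z n \<omega>) + ?h * \<epsilon> \<partial>M)"
      unfolding e_def
      by (rule markov_chain_expectation_Suc_le[OF mc, where g = "\<lambda>x. (1 + 2 * L * ?h) * f n x + ?h * \<epsilon>"])
        (use kernel in auto)
    also have "\<dots> = (1 + 2 * L * ?h) * e n + ?h * \<epsilon>"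
      unfolding e_def using int by (simp add: prob_space)
    finally show ?thesis .
  qed
  \<comment> \<open>The geometric sum produced by the recursion is replaced by \<open>n\<close>
    times a common upper bound of its terms.\<close>
  have "e n \<le> (1 + 2 * L * ?h) ^ n * (real n * ?h * \<epsilon>)"
  proof (induction n)
    case 0
    have "e 0 = (\<integral>\<omega>. 0 \<partial>M)"
      unfolding e_def using init
      by (intro integral_cong_AE borel_measurable_integrable int) (auto simp: f_def z_0)
    then show ?case by simp
  next
    case (Suc n)
    let ?q = "1 + 2 * L * ?h"
    have "?q \<ge> 1" using L_nonneg by simp
    have "e (Suc n) \<le> ?q * (?q ^ n * (real n * ?h * \<epsilon>)) + 1 * (?h * \<epsilon>)"
      using rec[of n] mult_left_mono[OF Suc.IH, of ?q] \<open>?q \<ge> 1\<close> by linarith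
    also have "\<dots> \<le> ?q * (?q ^ n * (real n * ?h * \<epsilon>)) + ?q ^ Suc n * (?h * \<epsilon>)"
      using \<open>?q \<ge> 1\<close> \<open>0 \<le> \<epsilon>\<close> by (intro add_left_mono mult_right_mono one_le_power) auto
    also have "\<dots> = ?q ^ Suc n * (real (Suc n) * ?h * \<epsilon>)"
      by (simp add: algebra_simps add_divide_distrib)
    finally show ?case .
  qed
  also have "\<dots> \<le> exp (2 * L * ?h) ^ n * (real n * ?h * \<epsilon>)"
    using L_nonneg \<open>0 \<le> \<epsilon>\<close> exp_ge_add_one_self[of "2 * L * ?h"]
    by (intro mult_right_mono power_mono) auto
  also have "exp (2 * L * ?h) ^ n = exp (2 * L * (real n / real N))"
    by (simp add: exp_of_nat_mult[symmetric] mult_ac)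
  finally show ?thesis
    by (simp add: e_def f_def \<epsilon>_def mult_ac)
qed

text \<open>Rounding \<open>t\<close> down to a multiple of \<open>1 / N\<close> changes
  \<open>w\<close> by at most \<open>(1 + L) / N\<close>. The square of the sum of the two errors is
  at most twice the sum of their squares.\<close>

lemma exploration_scaled_second_moment:
  assumes N: "N \<ge> 1" and chain: "exploration_chain p N M Z"
    and supp: "\<And>x. x < N \<Longrightarrow> set_pmf (p N x) \<subseteq> {0..N - x - 1}"
    and mean: "\<And>x. x < N \<Longrightarrow> \<bar>nb_mean p N x - \<gamma> (real x / real N)\<bar> \<le> \<delta>"
    and var: "\<And>x. x < N \<Longrightarrow> nb_var p N x \<le> \<psi>"
    and t: "0 \<le> t" "t \<le> T"
  shows "integrable M (\<lambda>\<omega>. (scaled N Z t \<omega> - w t)\<^sup>2)"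
    and "(\<integral>\<omega>. (scaled N Z t \<omega> - w t)\<^sup>2 \<partial>M)
           \<le> 2 * (exp (2 * L * T) * T * (2 * \<delta> + 3 * (1 / real N) * (1 + L + \<delta>)\<^sup>2 + \<psi> / real N))
             + 2 * ((1 + L) / real N)\<^sup>2"
proof -
  define n where "n = nat \<lfloor>t * real N\<rfloor>"
  define s where "s = real n / real N"
  define \<epsilon> where "\<epsilon> = 2 * \<delta> + 3 * (1 / real N) * (1 + L + \<delta>)\<^sup>2 + \<psi> / real N"
  define D where "D \<omega> = (real (Z n \<omega>) / real N - w s)\<^sup>2" for \<omega>
  have mc: "markov_chain M {0..N} (exploration_kernel p N) Z"
    using chain by (auto simp: exploration_chain_def)
  interpret prob_space M
    using mc by (simp add: markov_chain_def)
  have int: "integrable M (\<lambda>\<omega>. (real (Z n \<omega>) / real N - c)\<^sup>2)" for c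
    using markov_chain_has_expectation[OF mc, of "\<lambda>x. (real x / real N - c)\<^sup>2" n]
    by (auto simp: has_bochner_integral_iff)
  then show int_t: "integrable M (\<lambda>\<omega>. (scaled N Z t \<omega> - w t)\<^sup>2)"
    by (simp add: scaled_def n_def)
  have n: "real n \<le> t * real N" "t * real N \<le> real n + 1"
    using t N by (auto simp: n_def of_nat_nat)
  then have "s \<le> t" "t \<le> (real n + 1) / real N"
    using N by (auto simp: s_def pos_le_divide_eq pos_divide_le_eq)
  then have s: "0 \<le> s" "s \<le> t" "t - s \<le> 1 / real N"
    by (auto simp: s_def add_divide_distrib)
  have "0 \<le> \<delta>"
    using mean[of 0] N by linarith
  have "0 \<le> nb_var p N 0"
    unfolding nb_var_def by (intro sum_nonneg) auto
  then have "0 \<le> \<psi>"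
    using var[of 0] N by linarith
  have "0 \<le> \<epsilon>"
    unfolding \<epsilon>_def using \<open>0 \<le> \<delta>\<close> \<open>0 \<le> \<psi>\<close> by auto
  have "(t - s) * (1 + L) \<le> 1 / real N * (1 + L)"
    using s L_nonneg by (intro mult_right_mono) auto
  then have "\<bar>w t - w s\<bar> \<le> (1 + L) / real N"
    using w_growth[OF s(1,2)] by simp
  then have w_sq: "(w t - w s)\<^sup>2 \<le> ((1 + L) / real N)\<^sup>2"
    by (metis abs_ge_zero power2_abs power_mono)
  have square_sum: "(a - c)\<^sup>2 \<le> 2 * (a - b)\<^sup>2 + 2 * (c - b)\<^sup>2" for a b c :: real
    using zero_le_power2[of "a + c - 2 * b"] by (simp add: power2_eq_square algebra_simps)
  have "(\<integral>\<omega>. (scaled N Z t \<omega> - w t)\<^sup>2 \<partial>M) \<le> (\<integral>\<omega>. 2 * D \<omega> + 2 * ((1 + L) / real N)\<^sup>2 \<partial>M)"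
  proof (rule integral_mono[OF int_t])
    show "integrable M (\<lambda>\<omega>. 2 * D \<omega> + 2 * ((1 + L) / real N)\<^sup>2)"
      unfolding D_def using int by auto
    show "(scaled N Z t \<omega> - w t)\<^sup>2 \<le> 2 * D \<omega> + 2 * ((1 + L) / real N)\<^sup>2" for \<omega>
      using square_sum[of "scaled N Z t \<omega>" "w t" "w s"] w_sq
      unfolding D_def scaled_def n_def by (meson add_left_mono mult_left_mono order_trans zero_le_numeral)
  qed
  also have "\<dots> = 2 * (\<integral>\<omega>. D \<omega> \<partial>M) + 2 * ((1 + L) / real N)\<^sup>2"
    using int unfolding D_def by (simp add: prob_space)
  also have "(\<integral>\<omega>. D \<omega> \<partial>M) \<le> exp (2 * L * s) * s * \<epsilon>"
    unfolding D_def s_def \<epsilon>_def using assms by (intro exploration_second_moment) auto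
  also have "\<dots> \<le> exp (2 * L * T) * T * \<epsilon>"
    using s t L_nonneg \<open>0 \<le> \<epsilon>\<close> by (intro mult_right_mono mult_mono) (auto intro!: mult_left_mono)
  finally show "(\<integral>\<omega>. (scaled N Z t \<omega> - w t)\<^sup>2 \<partial>M)
           \<le> 2 * (exp (2 * L * T) * T * (2 * \<delta> + 3 * (1 / real N) * (1 + L + \<delta>)\<^sup>2 + \<psi> / real N))
             + 2 * ((1 + L) / real N)\<^sup>2"
    by (simp add: \<epsilon>_def)
qed

text \<open>Both functions are nondecreasing, so inside a cell their difference is controlled by the
  differences at the two end points plus the increment of \<open>w\<close> over the cell. The sum of
  squares serves every grid point at once.\<close>

lemma grid_bound:
  assumes mono: "\<And>s t. s \<le> t \<Longrightarrow> Y s \<le> Y t"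
    and T: "0 < T" and m: "m \<ge> 1" and \<eta>: "0 < \<eta>" and t: "0 \<le> t" "t \<le> T"
  shows "\<bar>Y t - w t\<bar> \<le> (1 + L) * (T / real m) + \<eta>
           + (\<Sum>i\<le>Suc m. (Y (real i * (T / real m)) - w (real i * (T / real m)))\<^sup>2) / \<eta>"
proof -
  define \<kappa> where "\<kappa> = T / real m"
  define D where "D i = Y (real i * \<kappa>) - w (real i * \<kappa>)" for i
  have "\<kappa> > 0" using T m by (simp add: \<kappa>_def)
  define i where "i = nat \<lfloor>t / \<kappa>\<rfloor>"
  have i: "real i \<le> t / \<kappa>" "t / \<kappa> \<le> real i + 1"
    using t \<open>\<kappa> > 0\<close> by (auto simp: i_def of_nat_nat)
  have "t / \<kappa> \<le> T / \<kappa>"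
    using t \<open>\<kappa> > 0\<close> by (simp add: divide_right_mono)
  also have "\<dots> = real m"
    using T m by (simp add: \<kappa>_def)
  \<comment> \<open>Equality occurs at \<open>t = T\<close>, so the right end point of the cell may
    have index \<open>Suc m\<close>.\<close>
  finally have "i \<le> m"
    using i by linarith
  have lower: "real i * \<kappa> \<le> t" and upper: "t \<le> real (Suc i) * \<kappa>"
    using i \<open>\<kappa> > 0\<close> by (auto simp: field_simps)
  have D_le: "\<bar>D j\<bar> \<le> \<eta> + (\<Sum>i\<le>Suc m. (D i)\<^sup>2) / \<eta>" if "j \<le> Suc m" for j
  proof -
    have "(D j)\<^sup>2 \<le> (\<Sum>i\<le>Suc m. (D i)\<^sup>2)"
      using that by (intro member_le_sum) auto
    then have "(D j)\<^sup>2 / \<eta> \<le> (\<Sum>i\<le>Suc m. (D i)\<^sup>2) / \<eta>"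
      using \<eta> by (intro divide_right_mono) auto
    then show ?thesis
      using abs_le_add_square_div[OF \<eta>, of "D j"] by linarith
  qed
  have "w (real (Suc i) * \<kappa>) - w (real i * \<kappa>) \<le> (real (Suc i) * \<kappa> - real i * \<kappa>) * (1 + L)"
    using \<open>\<kappa> > 0\<close> lower upper by (intro w_growth(2)) auto
  also have "\<dots> = (1 + L) * \<kappa>" by (simp add: algebra_simps)
  finally have w_step: "w (real (Suc i) * \<kappa>) - w (real i * \<kappa>) \<le> (1 + L) * \<kappa>" .
  have "w (real i * \<kappa>) \<le> w t" "w t \<le> w (real (Suc i) * \<kappa>)"
    using w_growth(1)[of "real i * \<kappa>" t] w_growth(1)[of t "real (Suc i) * \<kappa>"]
      lower upper t \<open>\<kappa> > 0\<close> by auto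
  moreover have "Y (real i * \<kappa>) \<le> Y t" "Y t \<le> Y (real (Suc i) * \<kappa>)"
    using lower upper by (auto intro: mono)
  ultimately have "Y t - w t \<le> D (Suc i) + (1 + L) * \<kappa>" "D i - (1 + L) * \<kappa> \<le> Y t - w t"
    using w_step unfolding D_def by linarith+
  then have "\<bar>Y t - w t\<bar> \<le> (1 + L) * \<kappa> + (\<eta> + (\<Sum>i\<le>Suc m. (D i)\<^sup>2) / \<eta>)"
    using D_le[of i] D_le[of "Suc i"] \<open>i \<le> m\<close> by linarith
  then show ?thesis
    by (simp add: D_def \<kappa>_def)
qed

text \<open>The expected supremum is bounded by a mesh term, \<open>\<eta>\<close> and a multiple of
  the uniform second moment bound \<open>B N\<close>. The mesh and \<open>\<eta>\<close> are fixed
  before \<open>N\<close> tends to infinity.\<close>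

theorem exploration_converges:
  assumes supp: "\<And>N x. x < N \<Longrightarrow> set_pmf (p N x) \<subseteq> {0..N - x - 1}"
    and chain: "\<And>N. N \<ge> 1 \<Longrightarrow> exploration_chain p N (M N) (Z N)"
    and mean: "\<And>N x. x < N \<Longrightarrow> \<bar>nb_mean p N x - \<gamma> (real x / real N)\<bar> \<le> \<delta> N"
    and var: "\<And>N x. x < N \<Longrightarrow> nb_var p N x \<le> \<psi> N"
    and \<delta>: "\<delta> \<longlonglongrightarrow> 0" and \<psi>: "(\<lambda>N. \<psi> N / real N) \<longlonglongrightarrow> 0" and T: "0 < T"
  shows "(\<lambda>N. \<integral>\<omega>. (SUP t\<in>{0..T}. \<bar>scaled N (Z N) t \<omega> - w t\<bar>) \<partial>M N) \<longlonglongrightarrow> 0"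
proof -
  define E where "E N = (\<integral>\<omega>. (SUP t\<in>{0..T}. \<bar>scaled N (Z N) t \<omega> - w t\<bar>) \<partial>M N)" for N
  \<comment> \<open>The horizon is \<open>2 * T\<close> because the last grid point
    \<open>(m + 1) * T / m\<close> lies beyond \<open>T\<close>.\<close>
  define B where "B N = 2 * (exp (2 * L * (2 * T)) * (2 * T)
      * (2 * \<delta> N + 3 * (1 / real N) * (1 + L + \<delta> N)\<^sup>2 + \<psi> N / real N)) + 2 * ((1 + L) / real N)\<^sup>2" for N
  have "B \<longlonglongrightarrow> 2 * (exp (2 * L * (2 * T)) * (2 * T) * (2 * 0 + 3 * 0 * (1 + L + 0)\<^sup>2 + 0)) + 2 * 0\<^sup>2"
    unfolding B_def by (intro tendsto_intros \<delta> \<psi> lim_1_over_n lim_const_over_n)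
  then have B_lim: "B \<longlonglongrightarrow> 0" by simp
  have E_nonneg: "0 \<le> E N" if "N \<ge> 1" for N
    unfolding E_def
  proof (rule integral_nonneg_AE, rule AE_I2)
    fix \<omega> assume \<omega>: "\<omega> \<in> space (M N)"
    have "\<bar>scaled N (Z N) t \<omega> - w t\<bar> \<le> 1" if "t \<in> {0..T}" for t
      using exploration_chain_bounds[OF chain[OF \<open>N \<ge> 1\<close>] \<omega>, of t] w_nonneg[of t] that
      by (auto simp: abs_le_iff)
    then have "bdd_above ((\<lambda>t. \<bar>scaled N (Z N) t \<omega> - w t\<bar>) ` {0..T})"
      by (rule bdd_above.I2)
    then show "0 \<le> (SUP t\<in>{0..T}. \<bar>scaled N (Z N) t \<omega> - w t\<bar>)"
      using T by (intro cSUP_upper2[of _ _ 0]) auto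
  qed
  have E_le: "E N \<le> (1 + L) * (T / real m) + \<eta> + real (m + 2) * B N / \<eta>"
    if "N \<ge> 1" "m \<ge> 1" "0 < \<eta>" for N m \<eta>
  proof -
    define g where "g i = real i * (T / real m)" for i
    define h where "h \<omega> = (1 + L) * (T / real m) + \<eta>
      + (\<Sum>i\<le>Suc m. (scaled N (Z N) (g i) \<omega> - w (g i))\<^sup>2) / \<eta>" for \<omega>
    note chain' = chain[OF \<open>N \<ge> 1\<close>]
    interpret prob_space "M N"
      using chain' by (simp add: exploration_chain_def markov_chain_def)
    have g: "0 \<le> g i" "g i \<le> 2 * T" if "i \<le> Suc m" for i
    proof -
      show "0 \<le> g i" using T by (simp add: g_def)
      have "g i \<le> (2 * real m) * (T / real m)"
        unfolding g_def using that \<open>m \<ge> 1\<close> T by (intro mult_right_mono) auto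
      then show "g i \<le> 2 * T" using \<open>m \<ge> 1\<close> by simp
    qed
    note moment = exploration_scaled_second_moment[OF \<open>N \<ge> 1\<close> chain' supp mean var g]
    have h_int: "integrable (M N) h"
      unfolding h_def using moment(1)
      by (intro Bochner_Integration.integrable_add Bochner_Integration.integrable_sum
          integrable_divide_zero integrable_const) auto
    have "E N \<le> (\<integral>\<omega>. h \<omega> \<partial>M N)"
      unfolding E_def
    \<comment> \<open>An integrable nonnegative majorant suffices: the integral of a function that
      is not integrable is \<open>0\<close> by convention.\<close>
    proof (rule integral_mono_AE'[OF h_int])
      show "AE \<omega> in M N. 0 \<le> h \<omega>"
        using L_nonneg T that unfolding h_def
        by (intro AE_I2 add_nonneg_nonneg divide_nonneg_pos sum_nonneg mult_nonneg_nonneg) auto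
      show "AE \<omega> in M N. (SUP t\<in>{0..T}. \<bar>scaled N (Z N) t \<omega> - w t\<bar>) \<le> h \<omega>"
        using exploration_chain_mono[OF chain']
      proof eventually_elim
        case (elim \<omega>)
        show ?case
        proof (rule cSUP_least)
          fix t assume "t \<in> {0..T}"
          then show "\<bar>scaled N (Z N) t \<omega> - w t\<bar> \<le> h \<omega>"
            unfolding h_def g_def using elim T that by (intro grid_bound) auto
        qed (use T in auto)
      qed
    qed
    also have "\<dots> = (1 + L) * (T / real m) + \<eta>
        + (\<Sum>i\<le>Suc m. (\<integral>\<omega>. (scaled N (Z N) (g i) \<omega> - w (g i))\<^sup>2 \<partial>M N)) / \<eta>"
    proof -
      have "integrable (M N) (\<lambda>\<omega>. \<Sum>i\<le>Suc m. (scaled N (Z N) (g i) \<omega> - w (g i))\<^sup>2)"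
        using moment(1) by (intro Bochner_Integration.integrable_sum) auto
      then have "(\<integral>\<omega>. h \<omega> \<partial>M N) = (1 + L) * (T / real m) + \<eta>
          + (\<integral>\<omega>. (\<Sum>i\<le>Suc m. (scaled N (Z N) (g i) \<omega> - w (g i))\<^sup>2) \<partial>M N) / \<eta>"
        unfolding h_def by (subst Bochner_Integration.integral_add) (auto simp: prob_space simp del: sum.atMost_Suc)
      also have "(\<integral>\<omega>. (\<Sum>i\<le>Suc m. (scaled N (Z N) (g i) \<omega> - w (g i))\<^sup>2) \<partial>M N)
          = (\<Sum>i\<le>Suc m. (\<integral>\<omega>. (scaled N (Z N) (g i) \<omega> - w (g i))\<^sup>2 \<partial>M N))"
        using moment(1) by (intro Bochner_Integration.integral_sum) auto
      finally show ?thesis .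
    qed
    also have "(\<Sum>i\<le>Suc m. (\<integral>\<omega>. (scaled N (Z N) (g i) \<omega> - w (g i))\<^sup>2 \<partial>M N)) \<le> (\<Sum>i\<le>Suc m. B N)"
      unfolding B_def by (intro sum_mono moment(2)) auto
    also have "(\<Sum>i\<le>Suc m. B N) = real (m + 2) * B N"
      by (simp add: algebra_simps)
    finally show ?thesis
      using \<open>0 < \<eta>\<close> by (simp add: divide_right_mono)
  qed
  have "E \<longlonglongrightarrow> 0"
  proof (rule tendstoI)
    fix \<epsilon> :: real assume "0 < \<epsilon>"
    \<comment> \<open>Each of the three terms gets a third of \<open>\<epsilon>\<close>:
      \<open>m\<close> is chosen for the mesh term, \<open>\<eta>\<close> will be
      \<open>\<epsilon> / 3\<close>, and \<open>N\<close> handles the rest.\<close>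
    obtain m0 :: nat where m0: "3 * (1 + L) * T / \<epsilon> < real m0"
      using reals_Archimedean2 by blast
    define m where "m = Suc m0"
    have "3 * (1 + L) * T < real m * \<epsilon>"
      using m0 \<open>0 < \<epsilon>\<close> by (simp add: m_def field_simps)
    then have m_small: "(1 + L) * (T / real m) < \<epsilon> / 3"
      by (simp add: m_def field_simps)
    have "(\<lambda>N. real (m + 2) * B N / (\<epsilon> / 3)) \<longlonglongrightarrow> real (m + 2) * 0 / (\<epsilon> / 3)"
      using \<open>0 < \<epsilon>\<close> by (intro tendsto_intros B_lim) auto
    then have "\<forall>\<^sub>F N in sequentially. real (m + 2) * B N / (\<epsilon> / 3) < \<epsilon> / 3"
      using \<open>0 < \<epsilon>\<close> by (intro order_tendstoD(2)[of _ 0]) auto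
    with eventually_ge_at_top[of 1] show "\<forall>\<^sub>F N in sequentially. dist (E N) 0 < \<epsilon>"
    proof eventually_elim
      case (elim N)
      then have "E N \<le> (1 + L) * (T / real m) + \<epsilon> / 3 + real (m + 2) * B N / (\<epsilon> / 3)"
        using \<open>0 < \<epsilon>\<close> by (intro E_le) (auto simp: m_def)
      then have "E N < \<epsilon>"
        using m_small elim(2) by linarith
      then show ?case
        using E_nonneg[of N] elim by simp
    qed
  qed
  then show ?thesis
    unfolding E_def[abs_def] .
qed

end

text \<open>The mean number of neighbours is nonnegative and vanishes for \<open>x = N - 1\<close>; in the limit this
  pins down the sign of \<open>\<gamma>\<close> on \<open>[0, 1]\<close> and its value at \<open>1\<close>.\<close>

lemma limit_drift_nonneg:
  assumes lip: "L-lipschitz_on {0..} \<gamma>"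
    and mean: "\<And>N x. x < N \<Longrightarrow> \<bar>nb_mean p N x - \<gamma> (real x / real N)\<bar> \<le> \<delta> N"
    and \<delta>: "\<delta> \<longlonglongrightarrow> 0" and u: "0 \<le> u" "u < 1"
  shows "0 \<le> \<gamma> u"
proof (rule LIMSEQ_le_const)
  show "(\<lambda>N. \<gamma> u + \<delta> N + L * (1 / real N)) \<longlonglongrightarrow> \<gamma> u"
    using tendsto_add[OF tendsto_add[OF tendsto_const \<delta>] tendsto_mult[OF tendsto_const lim_1_over_n]]
    by simp
  show "\<exists>N0. \<forall>N\<ge>N0. 0 \<le> \<gamma> u + \<delta> N + L * (1 / real N)"
  proof (intro exI allI impI)
    fix N :: nat assume N: "1 \<le> N"
    \<comment> \<open>The lattice point \<open>x / N\<close> lies within \<open>1 / N\<close> below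
      \<open>u\<close>, and \<open>u < 1\<close> ensures \<open>x < N\<close>, where the
      approximation of the mean applies.\<close>
    define x where "x = nat \<lfloor>u * real N\<rfloor>"
    have x: "real x \<le> u * real N" "u * real N \<le> real x + 1"
      using u N by (auto simp: x_def of_nat_nat)
    have "u * real N < 1 * real N"
      using u N by (intro mult_strict_right_mono) auto
    then have "x < N" using x by linarith
    have "real x / real N \<le> u" "u \<le> (real x + 1) / real N"
      using x N by (auto simp: pos_le_divide_eq pos_divide_le_eq)
    then have "0 \<le> u - real x / real N" "u - real x / real N \<le> 1 / real N"
      by (auto simp: add_divide_distrib)
    then have "L * \<bar>real x / real N - u\<bar> \<le> L * (1 / real N)"
      using lipschitz_on_nonneg[OF lip] by (intro mult_left_mono) auto
    moreover have "\<bar>\<gamma> (real x / real N) - \<gamma> u\<bar> \<le> L * \<bar>real x / real N - u\<bar>"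
      using lipschitz_onD[OF lip, of "real x / real N" u] u by (simp add: dist_real_def)
    moreover have "0 \<le> nb_mean p N x"
      unfolding nb_mean_def by (intro sum_nonneg) auto
    ultimately show "0 \<le> \<gamma> u + \<delta> N + L * (1 / real N)"
      using mean[OF \<open>x < N\<close>] by linarith
  qed
qed

lemma limit_drift_one:
  assumes lip: "L-lipschitz_on {0..} \<gamma>"
    and supp: "\<And>N x. x < N \<Longrightarrow> set_pmf (p N x) \<subseteq> {0..N - x - 1}"
    and mean: "\<And>N x. x < N \<Longrightarrow> \<bar>nb_mean p N x - \<gamma> (real x / real N)\<bar> \<le> \<delta> N"
    and \<delta>: "\<delta> \<longlonglongrightarrow> 0"
  shows "\<gamma> 1 = 0"
proof -
  have "\<bar>\<gamma> 1\<bar> \<le> 0"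
  proof (rule LIMSEQ_le_const)
    show "(\<lambda>N. \<delta> N + L * (1 / real N)) \<longlonglongrightarrow> 0"
      using tendsto_add[OF \<delta> tendsto_mult[OF tendsto_const lim_1_over_n]] by simp
    show "\<exists>N0. \<forall>N\<ge>N0. \<bar>\<gamma> 1\<bar> \<le> \<delta> N + L * (1 / real N)"
    proof (intro exI allI impI)
      fix N :: nat assume N: "1 \<le> N"
      have "k = 0" if "k \<in> set_pmf (p N (N - 1))" for k
        using supp[of "N - 1" N] N that by auto
      then have "nb_mean p N (N - 1) = 0"
        unfolding nb_mean_def by (intro sum.neutral) (auto simp: set_pmf_iff)
      moreover have "\<bar>nb_mean p N (N - 1) - \<gamma> (real (N - 1) / real N)\<bar> \<le> \<delta> N"
        using N by (intro mean) auto
      moreover have "\<bar>\<gamma> (real (N - 1) / real N) - \<gamma> 1\<bar> \<le> L * \<bar>real (N - 1) / real N - 1\<bar>"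
        using lipschitz_onD[OF lip, of "real (N - 1) / real N" 1] by (simp add: dist_real_def)
      moreover have "real (N - 1) / real N - 1 = - (1 / real N)"
        using N by (simp add: of_nat_diff field_simps)
      then have "\<bar>real (N - 1) / real N - 1\<bar> = 1 / real N"
        by simp
      ultimately show "\<bar>\<gamma> 1\<bar> \<le> \<delta> N + L * (1 / real N)"
        by (smt (verit))
    qed
  qed
  then show ?thesis by simp
qed

text \<open>The scaled chain never exceeds \<open>1\<close>, whereas \<open>z\<close> passes through
  \<open>1\<close> with slope \<open>1 + \<gamma> 1 = 1\<close>. Convergence to \<open>z\<close>
  itself is therefore claimed up to the time at which \<open>z\<close> reaches \<open>1\<close>, and
  convergence to the stopped solution on every compact interval.\<close>

theorem corollary2p4:
  fixes p :: "nat \<Rightarrow> nat \<Rightarrow> nat pmf"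
    and M :: "nat \<Rightarrow> 'a measure"
    and Z :: "nat \<Rightarrow> nat \<Rightarrow> 'a \<Rightarrow> nat"
    and \<gamma> z :: "real \<Rightarrow> real"
    and \<delta> :: "nat \<Rightarrow> real"
    and L :: real
  assumes "\<And>N x. x < N \<Longrightarrow> set_pmf (p N x) \<subseteq> {0..N - x - 1}"
    and "\<And>N. N \<ge> 1 \<Longrightarrow> exploration_chain p N (M N) (Z N)"
    and "L-lipschitz_on {0..} \<gamma>"
    and "\<And>N. N \<ge> 1 \<Longrightarrow> \<delta> N \<ge> 0"
    and "\<And>N. N \<ge> 1 \<Longrightarrow>
           (SUP x\<in>{..<N}. \<bar>nb_mean p N x - \<gamma> (real x / real N)\<bar>) \<le> \<delta> N"
    and "\<delta> \<longlonglongrightarrow> 0"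
    and "(\<lambda>N. nb_var_sup p N) \<in> o(\<lambda>N. real N)"
    and "solves_ivp_nonneg (\<lambda>u. 1 + \<gamma> u) z 0"
  shows "(\<forall>T>0. z T \<le> 1 \<longrightarrow>
            (\<lambda>N. \<integral>\<omega>. (SUP t\<in>{0..T}. \<bar>scaled N (Z N) t \<omega> - z t\<bar>) \<partial>M N) \<longlonglongrightarrow> 0) \<and>
         (\<forall>T>0.
            (\<lambda>N. \<integral>\<omega>. (SUP t\<in>{0..T}. \<bar>scaled N (Z N) t \<omega> - min (z t) 1\<bar>) \<partial>M N) \<longlonglongrightarrow> 0)"
proof -
  have mean: "\<bar>nb_mean p N x - \<gamma> (real x / real N)\<bar> \<le> \<delta> N" if "x < N" for N x
  proof -
    have "\<bar>nb_mean p N x - \<gamma> (real x / real N)\<bar>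
            \<le> (SUP x\<in>{..<N}. \<bar>nb_mean p N x - \<gamma> (real x / real N)\<bar>)"
      using that by (intro cSUP_upper) auto
    also have "\<dots> \<le> \<delta> N"
      using that by (intro assms(5)) auto
    finally show ?thesis .
  qed
  have var: "nb_var p N x \<le> nb_var_sup p N" if "x < N" for N x
    unfolding nb_var_sup_def using that by (intro cSUP_upper) auto
  have one: "\<gamma> 1 = 0"
    using limit_drift_one[OF assms(3) assms(1) mean assms(6)] .
  interpret fluid_limit \<gamma> z L
  proof
    \<comment> \<open>The limit argument covers \<open>u < 1\<close>; the end point is supplied by
      \<open>one\<close>.\<close>
    show "0 \<le> \<gamma> u" if "0 \<le> u" "u \<le> 1" for u
      using limit_drift_nonneg[OF assms(3) mean assms(6), of u] one that by (cases "u = 1") auto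
  qed (use assms(3,8) one in auto)
  have conv: "(\<lambda>N. \<integral>\<omega>. (SUP t\<in>{0..T}. \<bar>scaled N (Z N) t \<omega> - min (z t) 1\<bar>) \<partial>M N) \<longlonglongrightarrow> 0"
    if "0 < T" for T
    using exploration_converges[OF assms(1,2) mean var assms(6) smalloD_tendsto[OF assms(7)] that] .
  have "(\<lambda>N. \<integral>\<omega>. (SUP t\<in>{0..T}. \<bar>scaled N (Z N) t \<omega> - z t\<bar>) \<partial>M N) \<longlonglongrightarrow> 0"
    if "0 < T" "z T \<le> 1" for T
  proof -
    \<comment> \<open>If \<open>z T\<close> is at most \<open>1\<close>, then \<open>z\<close> has
      not exceeded \<open>1\<close> earlier, so stopping changes nothing on
      \<open>{0..T}\<close>.\<close>
    have "min (z t) 1 = z t" if "t \<in> {0..T}" for t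
      using z_le_one_before[of t T] that \<open>z T \<le> 1\<close> by simp
    then show ?thesis
      using conv[OF \<open>0 < T\<close>] by (simp cong: SUP_cong_simp)
  qed
  with conv show ?thesis by blast
qed

end
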